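(* For $i=1,2$ let $G_i$ be an $r_i$-regular graph with $n_i$ vertices and $m_i$ edges, and let $0=\tilde{\mu}_1(G_i)\le\tilde{\mu}_2(G_i)\le\dots\le\tilde{\mu}_{n_i}(G_i)$ be the normalized Laplacian eigenvalues of $G_i$. Write $N=n_1+n_2-1$. Then the normalized Laplacian characteristic polynomial $f(\mathcal{L}(G_1\dot{\vee}G_2),x)=\det\big(xI-\mathcal{L}(G_1\dot{\vee}G_2)\big)$ of the central vertex join equals $$(x-1)^{m_1-n_1}\prod_{i=2}^{n_2}\left(x-\frac{n_1}{r_2+n_1}-\frac{r_2}{r_2+n_1}\tilde{\mu}_i(G_2)\right)$$ $$\times\left[\Big(x-\frac{n_1}{r_2+n_1}\Big)\Big((x-1)^2-\frac{r_1}{N}-\frac{(1+r_1)(x-1)}{N}\Big)-\frac{n_1n_2(x-1)-n_1(x-1)(xn_1+xr_2-n_1)}{N(n_1+r_2)}\right]$$ $$\times\prod_{i=2}^{n_1}\left((x-1)^2-\frac{r_1}{N}-\frac{(1+r_1)(x-1)}{N}+\frac{r_1\tilde{\mu}_i(G_1)}{2N}+\frac{r_1(x-1)\tilde{\mu}_i(G_1)}{N}\right).$$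
   Context: All graphs are finite, simple and undirected. The central graph $C(G)$ of a graph $G$ is obtained by subdividing each edge of $G$ exactly once and joining every pair of vertices of $G$ that are non-adjacent in $G$. The central vertex join $G_1\dot{\vee}G_2$ of graphs $G_1$ (with $n_1$ vertices, $m_1$ edges) and $G_2$ (with $n_2$ vertices, $m_2$ edges) is obtained from the disjoint union of $C(G_1)$ and $G_2$ by joining each vertex of $C(G_1)$ that is an original vertex of $G_1$ with every vertex of $G_2$; it has $m_1+n_1+n_2$ vertices. For a graph $H$, the normalized Laplacian $\mathcal{L}(H)$ has $(i,j)$ entry $1$ if $i=j$ and $d_i\ne 0$, $-1/\sqrt{d_id_j}$ if $v_i\sim v_j$, and $0$ otherwise. *)

theory Defs
  imports
    "Jordan_Normal_Form.Char_Poly"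
    "HOL-Computational_Algebra.Polynomial_Factorial"
    "HOL-Library.Multiset"
begin

record 'a sgraph =
  verts :: "'a set"
  edges :: "'a set set"

definition simple_graph :: "'a sgraph \<Rightarrow> bool" where
  "simple_graph G \<longleftrightarrow> finite (verts G) \<and> (\<forall>e \<in> edges G. e \<subseteq> verts G \<and> card e = 2)"

definition adjacent :: "'a sgraph \<Rightarrow> 'a \<Rightarrow> 'a \<Rightarrow> bool" where
  "adjacent G u v \<longleftrightarrow> {u, v} \<in> edges G"

definition vdegree :: "'a sgraph \<Rightarrow> 'a \<Rightarrow> nat" where
  "vdegree G v = card {w \<in> verts G. adjacent G v w}"

definition regular_graph :: "'a sgraph \<Rightarrow> nat \<Rightarrow> bool" where
  "regular_graph G r \<longleftrightarrow> (\<forall>v \<in> verts G. vdegree G v = r)"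

text \<open>\<open>Inl v\<close> is the original vertex \<open>v\<close>; \<open>Inr e\<close> is the vertex subdividing the edge \<open>e\<close>.\<close>

definition central_graph :: "'a sgraph \<Rightarrow> ('a + 'a set) sgraph" where
  "central_graph G =
     \<lparr> verts = Inl ` verts G \<union> Inr ` edges G,
       edges = {{Inl v, Inr e} | v e. e \<in> edges G \<and> v \<in> e}
             \<union> {{Inl u, Inl v} | u v. u \<in> verts G \<and> v \<in> verts G \<and> u \<noteq> v \<and> \<not> adjacent G u v} \<rparr>"

definition central_vertex_join ::
    "'a sgraph \<Rightarrow> 'b sgraph \<Rightarrow> (('a + 'a set) + 'b) sgraph" where
  "central_vertex_join G H =
     \<lparr> verts = Inl ` verts (central_graph G) \<union> Inr ` verts H,
       edges = (`) Inl ` edges (central_graph G) \<union> (`) Inr ` edges H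
             \<union> {{Inl (Inl u), Inr w} | u w. u \<in> verts G \<and> w \<in> verts H} \<rparr>"

text \<open>Matrices of a graph are taken with respect to an enumeration \<open>vs\<close> of its vertices.\<close>

definition vertex_enum :: "'a sgraph \<Rightarrow> 'a list \<Rightarrow> bool" where
  "vertex_enum G vs \<longleftrightarrow> distinct vs \<and> set vs = verts G"

definition normalized_laplacian :: "'a sgraph \<Rightarrow> 'a list \<Rightarrow> real mat" where
  "normalized_laplacian G vs = mat (length vs) (length vs) (\<lambda>(i, j).
     if i = j \<and> vdegree G (vs ! i) \<noteq> 0 then 1
     else if adjacent G (vs ! i) (vs ! j)
       then - 1 / sqrt (real (vdegree G (vs ! i)) * real (vdegree G (vs ! j)))
     else 0)"

text \<open>
  The eigenvalues, listed in increasing order with multiplicity, are the real roots of the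
  characteristic polynomial. As the normalized Laplacian is real symmetric, there are
  \<open>length vs\<close> of them, and \<open>nl_eigenvalue G vs i\<close> is the \<open>i\<close>-th smallest for
  \<open>1 \<le> i \<le> length vs\<close>.
\<close>

definition nl_eigenvalue :: "'a sgraph \<Rightarrow> 'a list \<Rightarrow> nat \<Rightarrow> real" where
  "nl_eigenvalue G vs i =
     sorted_list_of_multiset (proots (char_poly (normalized_laplacian G vs))) ! (i - 1)"

text \<open>
  The indeterminate and the constants of the field \<open>\<real>(x)\<close> of rational functions. A factor
  \<open>(x - 1)\<^sup>k\<close> with a negative integer \<open>k\<close> makes sense there, but not in \<open>\<real>[x]\<close>.
\<close>

definition rf_X :: "real poly fract" where
  "rf_X = to_fract [:0, 1:]"

definition rf_const :: "real \<Rightarrow> real poly fract" where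
  "rf_const c = to_fract [:c:]"

end

theory Submission
  imports Defs
begin

text \<open>Order the vertices of the join as edge vertices, vertices of \<open>G1\<close>, vertices of \<open>G2\<close>, and
  write \<open>y = x - 1\<close>. The edge vertices form the scalar block \<open>y I\<close>, and the incidence matrix
  \<open>R\<close> of the \<open>r1\<close>-regular graph \<open>G1\<close> satisfies \<open>R R\<^sup>T = A + r1 I\<close>, so the Schur complement of that
  block only involves the identity, the normalized Laplacians of \<open>G1\<close> and \<open>G2\<close>, and constant
  blocks. As all row sums are constant, the constant blocks change the determinant only through
  the eigenvalue of the all-ones vector, which yields the middle factor. The remaining factors run
  over the other eigenvalues; these are all but the smallest, because the normalized Laplacian of
  a regular graph is diagonally dominant and kills the all-ones vector.\<close>

section \<open>Determinants of block matrices\<close>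

text \<open>Rows and columns carry labels instead of numbers. Concatenating label lists then yields
  block matrices, and a change of enumeration is a permutation of a list.\<close>

definition list_mat :: "('a \<Rightarrow> 'b \<Rightarrow> 'c) \<Rightarrow> 'a list \<Rightarrow> 'b list \<Rightarrow> 'c mat" where
  "list_mat f us ws = mat (length us) (length ws) (\<lambda>(i, j). f (us ! i) (ws ! j))"

lemma list_mat_carrier [simp]: "list_mat f us ws \<in> carrier_mat (length us) (length ws)"
  and dim_row_list_mat [simp]: "dim_row (list_mat f us ws) = length us"
  and dim_col_list_mat [simp]: "dim_col (list_mat f us ws) = length ws"
  and index_list_mat [simp]:
    "i < length us \<Longrightarrow> j < length ws \<Longrightarrow> list_mat f us ws $$ (i, j) = f (us ! i) (ws ! j)"
  by (auto simp: list_mat_def)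

lemma list_mat_cong:
  assumes "\<And>u w. u \<in> set us \<Longrightarrow> w \<in> set ws \<Longrightarrow> f u w = g u w"
  shows "list_mat f us ws = list_mat g us ws"
  using assms by (intro eq_matI) auto

lemma list_mat_map:
  "list_mat f (map g us) (map h ws) = list_mat (\<lambda>u w. f (g u) (h w)) us ws"
  by (intro eq_matI) auto

lemma list_mat_append:
  "list_mat f (us @ us') (ws @ ws') =
    four_block_mat (list_mat f us ws) (list_mat f us ws') (list_mat f us' ws) (list_mat f us' ws')"
  by (intro eq_matI) (auto simp: nth_append)

lemma list_mat_minus:
  "list_mat f us ws - list_mat g us ws = list_mat (\<lambda>u w. f u w - g u w :: 'c :: ab_group_add) us ws"
  by (intro eq_matI) auto

lemma list_mat_mult:
  fixes f :: "'a \<Rightarrow> 'b \<Rightarrow> 'c :: comm_semiring_0"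
  assumes "distinct vs"
  shows "list_mat f us vs * list_mat g vs ws = list_mat (\<lambda>u w. \<Sum>v\<in>set vs. f u v * g v w) us ws"
proof (intro eq_matI)
  fix i j assume "i < dim_row (list_mat (\<lambda>u w. \<Sum>v\<in>set vs. f u v * g v w) us ws)"
    "j < dim_col (list_mat (\<lambda>u w. \<Sum>v\<in>set vs. f u v * g v w) us ws)"
  moreover have "(\<Sum>k = 0..<length vs. f u (vs ! k) * g (vs ! k) w) = (\<Sum>v\<in>set vs. f u v * g v w)" for u w
    using sum.reindex_bij_betw[OF bij_betw_nth[OF assms refl refl], of "\<lambda>v. f u v * g v w"]
    by (simp add: atLeast0LessThan)
  ultimately show "(list_mat f us vs * list_mat g vs ws) $$ (i, j) =
      list_mat (\<lambda>u w. \<Sum>v\<in>set vs. f u v * g v w) us ws $$ (i, j)"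
    by (simp add: scalar_prod_def)
qed auto

lemma list_mat_mult_vec:
  fixes f :: "'a \<Rightarrow> 'b \<Rightarrow> 'c :: comm_semiring_0"
  assumes "distinct ws" and "i < length us"
  shows "(list_mat f us ws *\<^sub>v vec (length ws) (\<lambda>j. g (ws ! j))) $ i = (\<Sum>w\<in>set ws. f (us ! i) w * g w)"
  using sum.reindex_bij_betw[OF bij_betw_nth[OF assms(1) refl refl], of "\<lambda>w. f (us ! i) w * g w"] assms(2)
  by (simp add: scalar_prod_def atLeast0LessThan)

text \<open>Permuting rows and columns by the same \<open>p\<close> contributes the sign of
  \<open>p\<close> twice, and its square is \<open>1\<close>. This lets an arbitrary enumeration of
  the join be replaced by one that exhibits the blocks.\<close>

lemma det_list_mat_perm:
  assumes "mset us = mset ws"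
  shows "det (list_mat f us us) = det (list_mat f ws ws :: 'c :: comm_ring_1 mat)"
proof -
  obtain p where p: "p permutes {..<length ws}" and us: "permute_list p ws = us"
    using assms mset_eq_permutation by metis
  define n where "n = length ws"
  have p': "p permutes {0..<n}" using p by (simp add: n_def atLeast0LessThan)
  have len: "length us = n" using us by (auto simp: n_def)
  have pn: "p i < n" if "i < n" for i using permutes_in_image[OF p', of i] that by simp
  have nth: "us ! i = ws ! (p i)" if "i < n" for i
    using that permute_list_nth[OF p] us n_def by metis
  let ?A = "list_mat f ws ws"
  \<comment> \<open>The row rule is applied twice: once to the transpose, which permutes the
    columns, and once after transposing back.\<close>
  let ?B = "mat n n (\<lambda>(i, j). ?A\<^sup>T $$ (p i, j))"
  have A: "?A \<in> carrier_mat n n" by (simp add: n_def)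
  have "list_mat f us us = mat n n (\<lambda>(i, j). ?B\<^sup>T $$ (p i, j))"
    using len pn nth by (intro eq_matI) (auto simp: n_def)
  then have "det (list_mat f us us) = signof p * det (?B\<^sup>T)"
    using det_permute_rows[of "?B\<^sup>T" n p] p' by simp
  also have "det (?B\<^sup>T) = det ?B" by (rule det_transpose[of _ n]) simp
  also have "det ?B = signof p * det (?A\<^sup>T)"
    using det_permute_rows[of "?A\<^sup>T" n p] p' A by simp
  also have "det (?A\<^sup>T) = det ?A" by (rule det_transpose[OF A])
  finally show ?thesis by (simp add: sign_def)
qed

text \<open>The matrix factors into a block lower triangular one and a block unipotent one. The
  witness \<open>F\<close> plays the role of \<open>A^-1 B\<close>, so no inverse matrix has to be
  formed.\<close>

lemma det_four_block_schur_left: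
  fixes A :: "'a :: idom mat"
  assumes A: "A \<in> carrier_mat n n" and C: "C \<in> carrier_mat m n" and D: "D \<in> carrier_mat m m"
    and F: "F \<in> carrier_mat n m" and AF: "A * F = B"
  shows "det (four_block_mat A B C D) = det A * det (D - C * F)"
proof -
  have "four_block_mat A B C D =
      four_block_mat A (0\<^sub>m n m) C (D - C * F) * four_block_mat (1\<^sub>m n) F (0\<^sub>m m n) (1\<^sub>m m)"
    using assms by (subst mult_four_block_mat[of _ n n _ m _ m]) (auto intro!: cong_four_block_mat)
  also have "det \<dots> = det (four_block_mat A (0\<^sub>m n m) C (D - C * F)) *
      det (four_block_mat (1\<^sub>m n) F (0\<^sub>m m n) (1\<^sub>m m))"
    using assms by (intro det_mult[of _ "n + m"] four_block_carrier_mat) auto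
  also have "det (four_block_mat A (0\<^sub>m n m) C (D - C * F)) = det A * det (D - C * F)"
    using assms by (intro det_four_block_mat_upper_right_zero) auto
  also have "det (four_block_mat (1\<^sub>m n) F (0\<^sub>m m n) (1\<^sub>m m)) = 1"
    using F by (subst det_four_block_mat_lower_left_zero[of _ n _ m]) auto
  finally show ?thesis by simp
qed

text \<open>The mirror image: the lower right block is eliminated, and \<open>F\<close> plays the
  role of \<open>D^-1 C\<close>.\<close>

lemma det_four_block_schur_right:
  fixes A :: "'a :: idom mat"
  assumes A: "A \<in> carrier_mat n n" and B: "B \<in> carrier_mat n m" and D: "D \<in> carrier_mat m m"
    and F: "F \<in> carrier_mat m n" and DF: "D * F = C"
  shows "det (four_block_mat A B C D) = det D * det (A - B * F)"
proof -
  have "four_block_mat A B C D =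
      four_block_mat (A - B * F) B (0\<^sub>m m n) D * four_block_mat (1\<^sub>m n) (0\<^sub>m n m) F (1\<^sub>m m)"
    using assms by (subst mult_four_block_mat[of _ n n _ m _ m]) (auto intro!: cong_four_block_mat)
  also have "det \<dots> = det (four_block_mat (A - B * F) B (0\<^sub>m m n) D) *
      det (four_block_mat (1\<^sub>m n) (0\<^sub>m n m) F (1\<^sub>m m))"
    using assms by (intro det_mult[of _ "n + m"] four_block_carrier_mat) auto
  also have "det (four_block_mat (A - B * F) B (0\<^sub>m m n) D) = det (A - B * F) * det D"
    using assms by (intro det_four_block_mat_lower_left_zero) auto
  also have "det (four_block_mat (1\<^sub>m n) (0\<^sub>m n m) F (1\<^sub>m m)) = 1"
    using F by (subst det_four_block_mat_upper_right_zero[of _ n _ m]) auto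
  finally show ?thesis by (simp add: mult.commute)
qed

section \<open>Constant perturbations and constant off-diagonal blocks\<close>

lemma det_list_mat_single: "det (list_mat f [u] [w]) = f u w"
  by (subst det_single) (simp_all add: list_mat_def)

lemma det_list_mat_diag:
  assumes "distinct us"
  shows "det (list_mat (\<lambda>u v. if u = v then y else 0) us us) = (y :: 'a :: comm_ring_1) ^ length us"
proof -
  have "list_mat (\<lambda>u v. if u = v then y else 0) us us = y \<cdot>\<^sub>m 1\<^sub>m (length us)"
    using assms by (intro eq_matI) (auto simp: nth_eq_iff_index_eq)
  then show ?thesis by simp
qed

text \<open>Both Schur complements of the bordered matrix with blocks \<open>1\<close>, \<open>-c\<close>, \<open>1\<close>, \<open>f\<close> are used.\<close>

lemma det_list_mat_add_const:
  fixes f :: "'a \<Rightarrow> 'a \<Rightarrow> 'c :: field"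
  assumes us: "distinct us" and row: "\<And>u. u \<in> set us \<Longrightarrow> (\<Sum>v\<in>set us. f u v) = s" and s: "s \<noteq> 0"
  shows "det (list_mat (\<lambda>u v. f u v + c) us us) * s =
    det (list_mat f us us) * (s + c * of_nat (length us))"
proof -
  let ?o = "[()]"
  let ?M = "four_block_mat (list_mat (\<lambda>_ _. 1) ?o ?o) (list_mat (\<lambda>_ _. - c) ?o us)
      (list_mat (\<lambda>_ _. 1) us ?o) (list_mat f us us)"
  have "det ?M = det (list_mat (\<lambda>_ _. 1 :: 'c) ?o ?o) *
      det (list_mat f us us - list_mat (\<lambda>_ _. 1) us ?o * list_mat (\<lambda>_ _. - c) ?o us)"
    by (rule det_four_block_schur_left[of _ 1 _ "length us"]) (simp_all add: list_mat_mult, simp_all add: list_mat_def)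
  also have "\<dots> = det (list_mat (\<lambda>u v. f u v + c) us us)"
    by (simp add: list_mat_mult list_mat_minus det_list_mat_single)
  finally have 1: "det ?M = det (list_mat (\<lambda>u v. f u v + c) us us)" .
  have "det ?M = det (list_mat f us us) *
      det (list_mat (\<lambda>_ _. 1) ?o ?o - list_mat (\<lambda>_ _. - c) ?o us * list_mat (\<lambda>_ _. 1 / s) us ?o)"
  proof (rule det_four_block_schur_right[of _ 1 _ "length us"])
    \<comment> \<open>The all-ones vector is an eigenvector for \<open>s\<close>, so the constant
      column \<open>1 / s\<close> solves the system.\<close>
    show "list_mat f us us * list_mat (\<lambda>_ _. 1 / s) us ?o = list_mat (\<lambda>_ _. 1) us ?o"
      using row s unfolding list_mat_mult[OF us] sum_distrib_right[symmetric]
      by (intro list_mat_cong) simp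
  qed (simp_all add: list_mat_def)
  also have "\<dots> = det (list_mat f us us) * (1 + of_nat (length us) * (c / s))"
    using us by (simp add: list_mat_mult list_mat_minus det_list_mat_single distinct_card)
  finally show ?thesis using s 1 by (simp add: field_simps)
qed

text \<open>Eliminating the first block subtracts a constant from every entry of the second, so
  \<open>det_list_mat_add_const\<close> handles both blocks. The factor \<open>s * t\<close> on the
  left avoids dividing by the eigenvalues of the all-ones vectors.\<close>

lemma det_join:
  fixes f :: "'a \<Rightarrow> 'a \<Rightarrow> 'c :: field"
  assumes us: "distinct us" and f: "\<And>u. u \<in> set us \<Longrightarrow> (\<Sum>v\<in>set us. f u v) = s"
    and ws: "distinct ws" and g: "\<And>u. u \<in> set ws \<Longrightarrow> (\<Sum>v\<in>set ws. g u v) = t"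
    and nz: "s \<noteq> 0" "t \<noteq> 0" "s + c * of_nat (length us) \<noteq> 0"
  shows "det (four_block_mat (list_mat (\<lambda>u v. f u v + c) us us) (list_mat (\<lambda>_ _. d) us ws)
      (list_mat (\<lambda>_ _. d) ws us) (list_mat g ws ws)) * (s * t) =
    det (list_mat f us us) * det (list_mat g ws ws) *
      ((s + c * of_nat (length us)) * t - d\<^sup>2 * of_nat (length us) * of_nat (length ws))"
    (is "det ?M * _ = _")
proof -
  let ?s = "s + c * of_nat (length us)"
  let ?X = "list_mat (\<lambda>u v. f u v + c) us us"
  have row: "(\<Sum>v\<in>set us. f u v + c) = ?s" if "u \<in> set us" for u
    using f[OF that] us by (simp add: sum.distrib distinct_card mult.commute)
  have "det ?M = det ?X * det (list_mat g ws ws - list_mat (\<lambda>_ _. d) ws us * list_mat (\<lambda>_ _. d / ?s) us ws)"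
  proof (rule det_four_block_schur_left[of _ "length us" _ "length ws"])
    show "?X * list_mat (\<lambda>_ _. d / ?s) us ws = list_mat (\<lambda>_ _. d) us ws"
      using us row nz(3) unfolding list_mat_mult[OF us] sum_distrib_right[symmetric]
      by (intro list_mat_cong) simp
  qed auto
  also have "list_mat g ws ws - list_mat (\<lambda>_ _. d) ws us * list_mat (\<lambda>_ _. d / ?s) us ws =
      list_mat (\<lambda>u v. g u v + (- (d\<^sup>2 * of_nat (length us) / ?s))) ws ws"
    using us by (simp add: list_mat_mult list_mat_minus distinct_card power2_eq_square mult_ac)
  finally have "det ?M * (s * t) = (det ?X * s) *
      (det (list_mat (\<lambda>u v. g u v + (- (d\<^sup>2 * of_nat (length us) / ?s))) ws ws) * t)"
    by (simp only: mult_ac)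
  also have "\<dots> = (det (list_mat f us us) * ?s) *
      (det (list_mat g ws ws) * (t + (- (d\<^sup>2 * of_nat (length us) / ?s)) * of_nat (length ws)))"
    using det_list_mat_add_const[where f = f and c = c, OF us f nz(1)]
      det_list_mat_add_const[where f = g and c = "- (d\<^sup>2 * of_nat (length us) / ?s)", OF ws g nz(2)]
    by (simp only:)
  also have "\<dots> = det (list_mat f us us) * det (list_mat g ws ws) *
      (?s * (t + (- (d\<^sup>2 * of_nat (length us) / ?s)) * of_nat (length ws)))"
    by (simp only: mult_ac)
  \<comment> \<open>Only here does the denominator \<open>?s\<close> cancel: it was introduced by
    the elimination and comes back as a factor of the first determinant.\<close>
  also have "?s * (t + (- (d\<^sup>2 * of_nat (length us) / ?s)) * of_nat (length ws)) =
      ?s * t - d\<^sup>2 * of_nat (length us) * of_nat (length ws)"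
    using nz(3) by (simp add: right_diff_distrib)
  finally show ?thesis .
qed

section \<open>Affine combinations of the identity and a matrix\<close>

lemma degree_prod_list_linear: "degree (\<Prod>a\<leftarrow>as. [:- a, 1 :: 'a :: idom:]) = length as"
  by (subst degree_prod_list_eq) (auto simp: sum_list_triv o_def)

text \<open>Up to the factor \<open>(- \<beta>) ^ n\<close> this is the characteristic polynomial at
  \<open>- \<alpha> / \<beta>\<close>. The case \<open>\<beta> = 0\<close> is separate and does
  occur, namely for graphs of degree \<open>0\<close>.\<close>

lemma det_smult_one_add_smult:
  fixes A :: "'a :: field mat"
  assumes A: "A \<in> carrier_mat n n" and cp: "char_poly A = (\<Prod>a\<leftarrow>as. [:- a, 1:])"
  shows "det (\<alpha> \<cdot>\<^sub>m 1\<^sub>m n + \<beta> \<cdot>\<^sub>m A) = (\<Prod>a\<leftarrow>as. \<alpha> + \<beta> * a)"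
proof -
  have len: "length as = n"
    using degree_monic_char_poly[OF A] cp degree_prod_list_linear[of as] by simp
  show ?thesis
  proof (cases "\<beta> = 0")
    case True
    then have "\<alpha> \<cdot>\<^sub>m 1\<^sub>m n + \<beta> \<cdot>\<^sub>m A = \<alpha> \<cdot>\<^sub>m 1\<^sub>m n" using A by (intro eq_matI) auto
    with True len show ?thesis by (simp add: map_replicate_const)
  next
    case False
    have "\<alpha> \<cdot>\<^sub>m 1\<^sub>m n + \<beta> \<cdot>\<^sub>m A = (- \<beta>) \<cdot>\<^sub>m (- char_matrix A (- \<alpha> / \<beta>))"
      using A False by (intro eq_matI) (auto simp: char_matrix_def field_simps)
    then have "det (\<alpha> \<cdot>\<^sub>m 1\<^sub>m n + \<beta> \<cdot>\<^sub>m A) = (- \<beta>) ^ n * poly (char_poly A) (- \<alpha> / \<beta>)"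
      using A by (simp add: char_poly_matrix[OF A] char_matrix_def)
    also have "\<dots> = (\<Prod>a\<leftarrow>as. (- \<beta>) * (- \<alpha> / \<beta> - a))"
      unfolding cp len[symmetric] by (induction as) (auto simp: algebra_simps)
    also have "\<dots> = (\<Prod>a\<leftarrow>as. \<alpha> + \<beta> * a)"
      using False by (intro arg_cong[where f = prod_list] map_cong) (auto simp: field_simps)
    finally show ?thesis .
  qed
qed

section \<open>The normalized Laplacian spectrum of a regular graph\<close>

text \<open>The polynomial splits over the complex numbers, and a real symmetric matrix has only
  real eigenvalues, so the factorization descends to the reals.\<close>

lemma real_symmetric_char_poly_splits:
  fixes A :: "real mat"
  assumes A: "A \<in> carrier_mat n n" and sym: "A\<^sup>T = A"
  obtains as where "char_poly A = (\<Prod>a\<leftarrow>as. [:- a, 1:])"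
proof -
  interpret r: inj_comm_ring_hom complex_of_real by unfold_locales auto
  interpret rp: map_poly_inj_comm_ring_hom complex_of_real ..
  let ?C = "map_mat complex_of_real A"
  have C: "?C \<in> carrier_mat n n" using A by simp
  obtain as where as: "char_poly ?C = (\<Prod>a\<leftarrow>as. [:- a, 1:])"
    using char_poly_factorized[OF C] by blast
  have real: "complex_of_real (Re a) = a" if "a \<in> set as" for a
  proof -
    have "poly (char_poly ?C) a = 0"
      unfolding as poly_prod_list prod_list_zero_iff using that by force
    then obtain v where v: "v \<in> carrier_vec n" "v \<noteq> 0\<^sub>v n" "?C *\<^sub>v v = a \<cdot>\<^sub>v v"
      using eigenvalue_root_char_poly[OF C] C unfolding eigenvalue_def eigenvector_def by auto
    have "?C *\<^sub>v conjugate v = conjugate (?C *\<^sub>v v)"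
      using A v(1) by (intro eq_vecI) (auto simp: scalar_prod_def sum_conjugate conjugate_dist_mul)
    also have "\<dots> = conjugate a \<cdot>\<^sub>v conjugate v"
      by (simp add: v(3) conjugate_smult_vec)
    finally have conj: "?C *\<^sub>v conjugate v = conjugate a \<cdot>\<^sub>v conjugate v" .
    have CT: "?C\<^sup>T = ?C" using sym by (metis map_mat_transpose)
    \<comment> \<open>By symmetry the matrix moves to the conjugate vector, on which it acts by the
      conjugate of \<open>a\<close>. As \<open>v\<close> has nonzero norm, \<open>a\<close> equals
      its conjugate.\<close>
    have "a * (v \<bullet>c v) = (?C\<^sup>T *\<^sub>v v) \<bullet> conjugate v"
      using v by (simp add: CT)
    also have "\<dots> = v \<bullet> (?C *\<^sub>v conjugate v)"
      using v(1) C by (intro transpose_vec_mult_scalar) auto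
    also have "\<dots> = conjugate a * (v \<bullet>c v)"
      using v(1) by (simp add: conj)
    finally have "cnj a = a" using v by simp
    then show ?thesis by (simp add: complex_eq_iff)
  qed
  have "map_poly complex_of_real (char_poly A) = char_poly ?C"
    by (rule of_real_hom.char_poly_hom[OF A, symmetric])
  also have "\<dots> = (\<Prod>a\<leftarrow>as. map_poly complex_of_real [:- Re a, 1:])"
    unfolding as using real by (intro arg_cong[where f = prod_list] map_cong) auto
  also have "\<dots> = map_poly complex_of_real (\<Prod>a\<leftarrow>map Re as. [:- a, 1:])"
    by (simp add: rp.hom_prod_list o_def)
  finally have "char_poly A = (\<Prod>a\<leftarrow>map Re as. [:- a, 1:])"
    by simp
  then show ?thesis using that by blast
qed

text \<open>Gershgorin's argument in the row where the eigenvector has maximal modulus. The sum in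
  \<open>dom\<close> includes the diagonal entry, hence the factor \<open>2\<close>.\<close>

lemma diagonally_dominant_eigenvalue_nonneg:
  fixes A :: "real mat"
  assumes A: "A \<in> carrier_mat n n" and ev: "eigenvalue A a"
    and dom: "\<And>i. i < n \<Longrightarrow> (\<Sum>j<n. \<bar>A $$ (i, j)\<bar>) \<le> 2 * A $$ (i, i)"
  shows "a \<ge> 0"
proof -
  obtain v where v: "v \<in> carrier_vec n" "v \<noteq> 0\<^sub>v n" "A *\<^sub>v v = a \<cdot>\<^sub>v v"
    using ev A unfolding eigenvalue_def eigenvector_def by auto
  obtain k where k: "k < n" "v $ k \<noteq> 0" using v(1,2) by (auto simp: vec_eq_iff)
  let ?M = "(\<lambda>j. \<bar>v $ j\<bar>) ` {..<n}"
  have "Max ?M \<in> ?M" using k(1) by (intro Max_in) auto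
  then obtain i where i: "i < n" and "\<bar>v $ i\<bar> = Max ?M" by force
  then have max: "\<bar>v $ j\<bar> \<le> \<bar>v $ i\<bar>" if "j < n" for j using that by simp
  have pos: "\<bar>v $ i\<bar> > 0" using max[OF k(1)] k(2) by simp
  have "a * v $ i = (A *\<^sub>v v) $ i" using v i by simp
  also have "\<dots> = (\<Sum>j<n. A $$ (i, j) * v $ j)"
    using A v(1) i by (simp add: scalar_prod_def atLeast0LessThan)
  also have "\<dots> = A $$ (i, i) * v $ i + (\<Sum>j\<in>{..<n} - {i}. A $$ (i, j) * v $ j)"
    using i by (subst sum.remove[of _ i]) auto
  finally have "\<bar>(a - A $$ (i, i)) * v $ i\<bar> = \<bar>\<Sum>j\<in>{..<n} - {i}. A $$ (i, j) * v $ j\<bar>"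
    by (simp add: algebra_simps)
  also have "\<dots> \<le> (\<Sum>j\<in>{..<n} - {i}. \<bar>A $$ (i, j)\<bar> * \<bar>v $ i\<bar>)"
    using max by (intro order_trans[OF sum_abs] sum_mono) (auto simp: abs_mult intro: mult_left_mono)
  also have "\<dots> = ((\<Sum>j<n. \<bar>A $$ (i, j)\<bar>) - \<bar>A $$ (i, i)\<bar>) * \<bar>v $ i\<bar>"
    using i by (simp add: sum_distrib_right[symmetric] sum_diff1)
  also have "\<dots> \<le> A $$ (i, i) * \<bar>v $ i\<bar>"
    using dom[OF i] by (intro mult_right_mono) auto
  finally have "\<bar>a - A $$ (i, i)\<bar> \<le> A $$ (i, i)" using pos by (simp add: abs_mult)
  then show ?thesis by linarith
qed

definition nl_entry :: "'a sgraph \<Rightarrow> 'a \<Rightarrow> 'a \<Rightarrow> real" where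
  "nl_entry G u v = (if u = v \<and> vdegree G u \<noteq> 0 then 1
     else if adjacent G u v then - 1 / sqrt (real (vdegree G u) * real (vdegree G v)) else 0)"

lemma normalized_laplacian_list_mat:
  "distinct vs \<Longrightarrow> normalized_laplacian G vs = list_mat (nl_entry G) vs vs"
  by (intro eq_matI) (auto simp: normalized_laplacian_def nl_entry_def nth_eq_iff_index_eq)

section \<open>Laplacian entries and row sums of regular graphs\<close>

lemma adjacent_commute: "adjacent G u v \<longleftrightarrow> adjacent G v u"
  by (simp add: adjacent_def insert_commute)

lemma not_adjacent_self: "simple_graph G \<Longrightarrow> \<not> adjacent G u u"
  by (force simp: simple_graph_def adjacent_def)

lemma adjacent_verts: "simple_graph G \<Longrightarrow> adjacent G u v \<Longrightarrow> u \<in> verts G \<and> v \<in> verts G"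
  by (force simp: simple_graph_def adjacent_def)

lemma sum_adjacent:
  assumes "simple_graph G"
  shows "(\<Sum>v\<in>verts G. if adjacent G u v then c else 0) = of_nat (vdegree G u) * (c :: 'c :: semiring_1)"
  using assms by (simp add: simple_graph_def vdegree_def sum.If_cases Int_def)

lemma nl_entry_commute: "nl_entry G u v = nl_entry G v u"
  by (auto simp: nl_entry_def adjacent_commute mult.commute)

lemma nl_entry_regular:
  assumes "simple_graph G" "regular_graph G r" "u \<in> verts G" "v \<in> verts G"
  shows "nl_entry G u v = (if u = v then of_bool (r \<noteq> 0) else if adjacent G u v then - 1 / real r else 0)"
  using assms not_adjacent_self[OF assms(1)] by (auto simp: nl_entry_def regular_graph_def)

lemma regular_not_adjacent:
  assumes "simple_graph G" "regular_graph G 0"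
  shows "\<not> adjacent G u v"
proof
  assume uv: "adjacent G u v"
  then have "u \<in> verts G" "v \<in> verts G" using adjacent_verts assms(1) by metis+
  moreover from this have "{w \<in> verts G. adjacent G u w} = {}"
    using assms by (auto simp: simple_graph_def regular_graph_def vdegree_def)
  ultimately show False using uv by blast
qed

text \<open>Scaling by the degree gives the ordinary Laplacian \<open>r I - A\<close>. In this form
  degree \<open>0\<close> is no exception: both sides vanish, as there are no edges.\<close>

lemma nl_entry_regular':
  assumes "simple_graph G" "regular_graph G r" "u \<in> verts G" "v \<in> verts G"
  shows "real r * nl_entry G u v = (if u = v then real r else 0) - of_bool (adjacent G u v)"
  using nl_entry_regular[OF assms] not_adjacent_self[OF assms(1)] regular_not_adjacent[OF assms(1)] assms(2)
  by (cases "r = 0") auto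

text \<open>For \<open>r > 0\<close> the diagonal entry \<open>1\<close> faces \<open>r\<close>
  entries \<open>- 1 / r\<close>; for \<open>r = 0\<close> the row is zero. The first sum makes the
  all-ones vector a null vector, the second gives diagonal dominance.\<close>

lemma nl_entry_row_sums:
  assumes G: "simple_graph G" "regular_graph G r" and u: "u \<in> verts G"
  shows "(\<Sum>v\<in>verts G. nl_entry G u v) = 0"
    and "(\<Sum>v\<in>verts G. \<bar>nl_entry G u v\<bar>) = 2 * nl_entry G u u"
proof -
  have fin: "finite (verts G)" using G(1) by (simp add: simple_graph_def)
  have deg: "vdegree G u = r" using G(2) u by (simp add: regular_graph_def)
  have "nl_entry G u v = (if u = v then of_bool (r \<noteq> 0) else 0) + (if adjacent G u v then - 1 / real r else 0)"
    if "v \<in> verts G" for v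
    using nl_entry_regular[OF G u that] not_adjacent_self[OF G(1)] by auto
  then have "(\<Sum>v\<in>verts G. nl_entry G u v) =
      (\<Sum>v\<in>verts G. (if u = v then of_bool (r \<noteq> 0) else 0) + (if adjacent G u v then - 1 / real r else 0))"
    by (rule sum.cong[OF refl])
  also have "\<dots> = of_bool (r \<noteq> 0) + real r * (- 1 / real r)"
    using fin u unfolding sum.distrib sum_adjacent[OF G(1)] deg by simp
  finally show "(\<Sum>v\<in>verts G. nl_entry G u v) = 0" by simp
  have "\<bar>nl_entry G u v\<bar> = (if u = v then of_bool (r \<noteq> 0) else 0) + (if adjacent G u v then 1 / real r else 0)"
    if "v \<in> verts G" for v
    using nl_entry_regular[OF G u that] not_adjacent_self[OF G(1)] by auto
  then have "(\<Sum>v\<in>verts G. \<bar>nl_entry G u v\<bar>) =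
      (\<Sum>v\<in>verts G. (if u = v then of_bool (r \<noteq> 0) else 0) + (if adjacent G u v then 1 / real r else 0))"
    by (rule sum.cong[OF refl])
  also have "\<dots> = of_bool (r \<noteq> 0) + real r * (1 / real r)"
    using fin u unfolding sum.distrib sum_adjacent[OF G(1)] deg by simp
  finally show "(\<Sum>v\<in>verts G. \<bar>nl_entry G u v\<bar>) = 2 * nl_entry G u u"
    using nl_entry_regular[OF G u u] by simp
qed

section \<open>The sorted spectrum of a regular graph\<close>

lemma prod_list_sort:
  fixes f :: "'a :: linorder \<Rightarrow> 'b :: comm_monoid_mult"
  shows "(\<Prod>a\<leftarrow>sort as. f a) = (\<Prod>a\<leftarrow>as. f a)"
  by (metis mset_map mset_sort prod_mset_prod_list)

lemma proots_prod_list_linear: "proots (\<Prod>a\<leftarrow>as. [:- a, 1 :: 'a :: idom:]) = mset as"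
proof (induction as)
  case (Cons a as)
  have "(\<Prod>a\<leftarrow>as. [:- a, 1 :: 'a:]) \<noteq> 0" by (auto simp: prod_list_zero_iff)
  with Cons show ?case by (simp add: proots_mult del: mult_pCons_left)
qed simp

text \<open>Splits off the eigenvalue \<open>0\<close> of the all-ones vector. Since no eigenvalue
  is negative, it is the first in the sorted list, so the others are exactly those numbered from
  \<open>2\<close> on.\<close>

lemma regular_nl_spectrum:
  assumes G: "simple_graph G" "regular_graph G r" and vs: "vertex_enum G vs" and ne: "verts G \<noteq> {}"
  obtains \<mu>s where "char_poly (normalized_laplacian G vs) = (\<Prod>a\<leftarrow>0 # \<mu>s. [:- a, 1:])"
    and "length vs = Suc (length \<mu>s)"
    and "\<And>i. i < length \<mu>s \<Longrightarrow> nl_eigenvalue G vs (i + 2) = \<mu>s ! i"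
proof -
  have dist: "distinct vs" and set: "set vs = verts G" using vs by (auto simp: vertex_enum_def)
  let ?n = "length vs"
  let ?L = "normalized_laplacian G vs"
  have L: "?L = list_mat (nl_entry G) vs vs" by (rule normalized_laplacian_list_mat[OF dist])
  have carrier: "?L \<in> carrier_mat ?n ?n" by (simp add: L)
  have "?L\<^sup>T = ?L" unfolding L by (intro eq_matI) (auto simp: nl_entry_commute)
  then obtain as where as: "char_poly ?L = (\<Prod>a\<leftarrow>as. [:- a, 1:])"
    using real_symmetric_char_poly_splits[OF carrier] by blast
  have root: "eigenvalue ?L a \<longleftrightarrow> a \<in> set as" for a
    unfolding eigenvalue_root_char_poly[OF carrier] as poly_prod_list prod_list_zero_iff by force
  have "?n > 0" using ne set by auto
  let ?o = "vec ?n (\<lambda>j. 1 :: real)"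
  have "?L *\<^sub>v ?o = 0 \<cdot>\<^sub>v ?o"
  proof (intro eq_vecI)
    fix i assume "i < dim_vec (0 \<cdot>\<^sub>v ?o)"
    then have i: "i < ?n" by simp
    then have "vs ! i \<in> verts G" using set nth_mem by blast
    then show "(?L *\<^sub>v ?o) $ i = (0 \<cdot>\<^sub>v ?o) $ i"
      using list_mat_mult_vec[OF dist i, of "nl_entry G" "\<lambda>_. 1"] nl_entry_row_sums(1)[OF G, of "vs ! i"] i
      by (simp add: L set)
  qed (simp add: L)
  moreover have "?o \<noteq> 0\<^sub>v ?n" using \<open>?n > 0\<close> by (auto simp: vec_eq_iff)
  ultimately have "eigenvalue ?L 0"
    unfolding eigenvalue_def eigenvector_def by (intro exI[of _ ?o]) (simp add: L)
  then have zero: "0 \<in> set as" by (simp add: root)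
  have "(\<Sum>j<?n. \<bar>?L $$ (i, j)\<bar>) \<le> 2 * ?L $$ (i, i)" if "i < ?n" for i
  proof -
    have "vs ! i \<in> verts G" using set nth_mem that by blast
    moreover have "(\<Sum>j<?n. \<bar>?L $$ (i, j)\<bar>) = (\<Sum>v\<in>verts G. \<bar>nl_entry G (vs ! i) v\<bar>)"
      unfolding L set[symmetric] using that sum.reindex_bij_betw[OF bij_betw_nth[OF dist refl refl], of "\<lambda>v. \<bar>nl_entry G (vs ! i) v\<bar>"]
      by simp
    ultimately show ?thesis using nl_entry_row_sums(2)[OF G, of "vs ! i"] that by (simp add: L)
  qed
  then have nonneg: "a \<ge> 0" if "a \<in> set as" for a
    using diagonally_dominant_eigenvalue_nonneg[OF carrier] root that by blast
  obtain a \<mu>s where sort: "sort as = a # \<mu>s" using zero by (cases "sort as") (auto simp flip: set_empty)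
  have "a \<in> set as" by (metis sort list.set_intros(1) set_sort)
  moreover have "a \<le> 0" using zero sort sorted_sort[of as] by (metis set_ConsD set_sort sorted_simps(2) order_refl)
  ultimately have "a = 0" using nonneg by force
  with sort have sort: "sort as = 0 # \<mu>s" by simp
  show thesis
  proof (rule that)
    show cp: "char_poly ?L = (\<Prod>a\<leftarrow>0 # \<mu>s. [:- a, 1:])"
      using as prod_list_sort[of "\<lambda>a. [:- a, 1:]" as] by (simp only: sort)
    show "?n = Suc (length \<mu>s)"
      using degree_monic_char_poly[OF carrier] cp degree_prod_list_linear[of "0 # \<mu>s"] by simp
    \<comment> \<open>Eigenvalues are numbered from \<open>1\<close> and list positions from
      \<open>0\<close>, so number \<open>i + 2\<close> is position \<open>i + 1\<close> of
      \<open>0 # \<mu>s\<close>.\<close>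
    show "nl_eigenvalue G vs (i + 2) = \<mu>s ! i" for i
      by (simp add: nl_eigenvalue_def as proots_prod_list_linear sort)
  qed
qed

section \<open>Characteristic matrices over the field of rational functions\<close>

lemma rf_const_hom [simp]:
  "rf_const 0 = 0" "rf_const 1 = 1" "rf_const (a + b) = rf_const a + rf_const b"
  "rf_const (a * b) = rf_const a * rf_const b" "rf_const (- a) = - rf_const a"
  "rf_const (a - b) = rf_const a - rf_const b"
  by (simp_all add: rf_const_def flip: to_fract_add to_fract_mult to_fract_uminus to_fract_diff one_pCons)

lemma rf_const_of_nat [simp]: "rf_const (of_nat n) = of_nat n"
  by (induction n) simp_all

lemma rf_const_numeral [simp]: "rf_const (numeral n) = numeral n"
  by (metis of_nat_numeral rf_const_of_nat)

lemma rf_const_eq_0_iff [simp]: "rf_const a = 0 \<longleftrightarrow> a = 0"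
  by (simp add: rf_const_def)

interpretation rf_const: field_hom rf_const
  by unfold_locales simp_all

lemma rf_const_divide [simp]: "rf_const (a / b) = rf_const a / rf_const b"
  by (simp add: divide_inverse rf_const.hom_inverse)

lemma rf_const_sum: "rf_const (\<Sum>v\<in>A. f v) = (\<Sum>v\<in>A. rf_const (f v))"
  by (rule rf_const.hom_sum)

text \<open>Characteristic zero makes the degrees \<open>N\<close> and \<open>q\<close>, positive
  natural numbers, invertible in the field.\<close>

instance fract :: ("{idom, ring_char_0}") ring_char_0
proof
  show "inj (of_nat :: nat \<Rightarrow> 'a fract)"
    by (rule injI) (metis of_nat_fract of_nat_eq_iff eq_fract(1) mult.right_neutral zero_neq_one)
qed

text \<open>The polynomial is monic of degree 2. The row sums by which the elimination divides have
  this shape after multiplication by \<open>x - 1\<close>.\<close>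

lemma rf_quadratic_nonzero: "(rf_X - 1)\<^sup>2 - rf_const a - rf_const b * (rf_X - 1) \<noteq> 0"
proof -
  have "(rf_X - 1)\<^sup>2 - rf_const a - rf_const b * (rf_X - 1) =
      to_fract ([:-1, 1:]\<^sup>2 - [:a:] - [:b:] * [:-1, 1:])"
    unfolding rf_X_def rf_const_def power2_eq_square by (simp flip: to_fract_1 to_fract_diff to_fract_mult add: one_pCons)
  also have "\<dots> \<noteq> 0" by (simp add: power2_eq_square)
  finally show ?thesis .
qed

lemma rf_linear_nonzero: "rf_X - rf_const a \<noteq> 0"
  unfolding rf_X_def rf_const_def by (simp flip: to_fract_diff)

lemma rf_linear_nonzero': "rf_X - 1 \<noteq> 0"
  using rf_linear_nonzero[of 1] by simp

text \<open>The entries of \<open>x I - L\<close> over the rational functions, where the Schur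
  complement may divide by \<open>x - 1\<close>.\<close>

definition char_entry :: "'a sgraph \<Rightarrow> 'a \<Rightarrow> 'a \<Rightarrow> real poly fract" where
  "char_entry G u v = (if u = v then rf_X else 0) - rf_const (nl_entry G u v)"

lemma to_fract_char_poly_normalized_laplacian:
  assumes "distinct vs"
  shows "to_fract (char_poly (normalized_laplacian G vs)) = det (list_mat (char_entry G) vs vs)"
proof -
  interpret to_fract: comm_ring_hom "to_fract :: real poly \<Rightarrow> real poly fract"
    by unfold_locales auto
  have "map_mat to_fract (char_poly_matrix (normalized_laplacian G vs)) = list_mat (char_entry G) vs vs"
    unfolding normalized_laplacian_list_mat[OF assms] using assms
    by (intro eq_matI) (auto simp: char_poly_matrix_def char_entry_def rf_X_def rf_const_def nth_eq_iff_index_eq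
        simp flip: to_fract_uminus to_fract_diff)
  then show ?thesis unfolding char_poly_def by (metis to_fract.hom_det)
qed

text \<open>The real factorization is transported along \<open>rf_const\<close>, because the
  coefficients \<open>\<alpha>\<close> and \<open>\<beta>\<close> will be rational
  functions.\<close>

lemma det_nl_entry_affine:
  assumes vs: "distinct vs" and cp: "char_poly (normalized_laplacian G vs) = (\<Prod>a\<leftarrow>as. [:- a, 1:])"
  shows "det (list_mat (\<lambda>u v. (if u = v then \<alpha> else 0) + \<beta> * rf_const (nl_entry G u v)) vs vs) =
    (\<Prod>a\<leftarrow>as. \<alpha> + \<beta> * rf_const a)"
proof -
  interpret poly: map_poly_comm_ring_hom rf_const ..
  let ?L = "normalized_laplacian G vs"
  have L: "?L \<in> carrier_mat (length vs) (length vs)" by (simp add: normalized_laplacian_def)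
  have "char_poly (map_mat rf_const ?L) = (\<Prod>a\<leftarrow>map rf_const as. [:- a, 1:])"
    unfolding rf_const.char_poly_hom[OF L] cp by (simp add: poly.hom_prod_list o_def)
  then have "det (\<alpha> \<cdot>\<^sub>m 1\<^sub>m (length vs) + \<beta> \<cdot>\<^sub>m map_mat rf_const ?L) = (\<Prod>a\<leftarrow>map rf_const as. \<alpha> + \<beta> * a)"
    using L by (intro det_smult_one_add_smult) auto
  also have "\<alpha> \<cdot>\<^sub>m 1\<^sub>m (length vs) + \<beta> \<cdot>\<^sub>m map_mat rf_const ?L =
      list_mat (\<lambda>u v. (if u = v then \<alpha> else 0) + \<beta> * rf_const (nl_entry G u v)) vs vs"
    using vs by (intro eq_matI) (auto simp: normalized_laplacian_list_mat nth_eq_iff_index_eq)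
  finally show ?thesis by (simp add: o_def)
qed

section \<open>The central vertex join\<close>

lemma card_edges_at:
  assumes G: "simple_graph G"
  shows "card {e \<in> edges G. u \<in> e} = vdegree G u"
proof -
  have "{e \<in> edges G. u \<in> e} = (\<lambda>w. {u, w}) ` {w \<in> verts G. adjacent G u w}"
  proof (intro equalityI subsetI)
    fix e assume e: "e \<in> {e \<in> edges G. u \<in> e}"
    then have "card e = 2" "u \<in> e" using G by (auto simp: simple_graph_def)
    then obtain w where "e = {u, w}" unfolding card_2_iff by (metis insertE insert_commute singletonD)
    with e G show "e \<in> (\<lambda>w. {u, w}) ` {w \<in> verts G. adjacent G u w}"
      by (auto simp: simple_graph_def adjacent_def)
  qed (auto simp: adjacent_def)
  moreover have "inj_on (\<lambda>w. {u, w}) A" for A :: "'a set"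
    by (auto simp: inj_on_def doubleton_eq_iff)
  ultimately show ?thesis by (simp add: card_image vdegree_def)
qed

lemma finite_edges: "simple_graph G \<Longrightarrow> finite (edges G)"
  by (rule finite_subset[of _ "Pow (verts G)"]) (auto simp: simple_graph_def)

text \<open>The entries of \<open>c R R^T\<close> for the incidence matrix \<open>R\<close>: the
  diagonal counts the edges at a vertex, and two distinct vertices share at most the edge
  \<open>{u, v}\<close>.\<close>

lemma sum_incidence:
  assumes G: "simple_graph G"
  shows "(\<Sum>e\<in>edges G. if u \<in> e \<and> v \<in> e then c else 0) =
    (if u = v then of_nat (vdegree G u) else of_bool (adjacent G u v)) * (c :: 'c :: semiring_1)"
proof -
  have edge: "e = {u, v}" if "u \<noteq> v" "e \<in> edges G" "u \<in> e" "v \<in> e" for e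
  proof -
    have "finite e" "card e = 2" using that G by (auto simp: simple_graph_def intro: finite_subset)
    then show ?thesis using that card_seteq[of e "{u, v}"] by auto
  qed
  have "{e \<in> edges G. u \<in> e \<and> v \<in> e} = (if adjacent G u v then {{u, v}} else {})" if "u \<noteq> v"
  proof -
    have "{e \<in> edges G. u \<in> e \<and> v \<in> e} = {e \<in> edges G. e = {u, v}}" using edge[OF that] by blast
    then show ?thesis by (auto simp: adjacent_def)
  qed
  then show ?thesis
    using card_edges_at[OF G, of u] finite_edges[OF G]
    by (auto simp: sum.If_cases Int_def)
qed

section \<open>Adjacency and degrees in the join\<close>

lemma image_Inl_doubleton: "{Inl a, Inl b} \<in> (`) Inl ` S \<longleftrightarrow> {a, b} \<in> S"
  using inj_image_mem_iff[of "(`) Inl" "{a, b}" S] by (simp add: inj_def inj_image_eq_iff)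

lemma image_Inr_doubleton: "{Inr a, Inr b} \<in> (`) Inr ` S \<longleftrightarrow> {a, b} \<in> S"
  using inj_image_mem_iff[of "(`) Inr" "{a, b}" S] by (simp add: inj_def inj_image_eq_iff)

lemma not_in_image_image: "x \<in> e \<Longrightarrow> x \<notin> range f \<Longrightarrow> e \<notin> (`) f ` S"
  by blast

lemma adjacent_central_graph:
  "adjacent (central_graph G) (Inl u) (Inl v) \<longleftrightarrow> u \<in> verts G \<and> v \<in> verts G \<and> u \<noteq> v \<and> \<not> adjacent G u v"
  "adjacent (central_graph G) (Inl u) (Inr e) \<longleftrightarrow> e \<in> edges G \<and> u \<in> e"
  "adjacent (central_graph G) (Inr e) (Inl u) \<longleftrightarrow> e \<in> edges G \<and> u \<in> e"
  "\<not> adjacent (central_graph G) (Inr e) (Inr e')"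
  by (auto simp: adjacent_def central_graph_def doubleton_eq_iff insert_commute)

lemma adjacent_join:
  "adjacent (central_vertex_join G H) (Inl a) (Inl b) \<longleftrightarrow> adjacent (central_graph G) a b"
  "adjacent (central_vertex_join G H) (Inr w) (Inr w') \<longleftrightarrow> adjacent H w w'"
  "adjacent (central_vertex_join G H) (Inl a) (Inr w) \<longleftrightarrow> (\<exists>u\<in>verts G. a = Inl u) \<and> w \<in> verts H"
  "adjacent (central_vertex_join G H) (Inr w) (Inl a) \<longleftrightarrow> (\<exists>u\<in>verts G. a = Inl u) \<and> w \<in> verts H"
  using not_in_image_image[of "Inl a" _ Inr] not_in_image_image[of "Inr w" _ Inl]
  by (auto simp: adjacent_def central_vertex_join_def doubleton_eq_iff image_Inl_doubleton image_Inr_doubleton)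

lemma verts_join: "verts (central_vertex_join G H) =
    (\<lambda>u. Inl (Inl u)) ` verts G \<union> (\<lambda>e. Inl (Inr e)) ` edges G \<union> Inr ` verts H"
  by (auto simp: central_vertex_join_def central_graph_def)

lemma card_join_Un:
  assumes "finite A" "finite B" "finite C"
  shows "card ((\<lambda>u. Inl (Inl u)) ` A \<union> (\<lambda>e. Inl (Inr e)) ` B \<union> Inr ` C) = card A + card B + card C"
  using assms
  by (subst card_Un_disjoint, force, force, force, subst card_Un_disjoint) (auto simp: card_image inj_on_def)

text \<open>In the central graph an original vertex trades each neighbour for the vertex subdividing
  the joining edge. Its degree there is thus \<open>card (verts G) - 1\<close>, whatever its degree
  in \<open>G\<close>.\<close>

lemma vdegree_join:
  assumes G: "simple_graph G" and H: "simple_graph H"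
  shows "u \<in> verts G \<Longrightarrow> vdegree (central_vertex_join G H) (Inl (Inl u)) = card (verts G) + card (verts H) - 1"
    and "e \<in> edges G \<Longrightarrow> vdegree (central_vertex_join G H) (Inl (Inr e)) = 2"
    and "w \<in> verts H \<Longrightarrow> vdegree (central_vertex_join G H) (Inr w) = vdegree H w + card (verts G)"
proof -
  have fin: "finite (verts G)" "finite (verts H)" "finite (edges G)"
    using G H finite_edges by (auto simp: simple_graph_def)
  let ?J = "central_vertex_join G H"
  show "vdegree ?J (Inl (Inl u)) = card (verts G) + card (verts H) - 1" if u: "u \<in> verts G"
  proof -
    let ?A = "{v \<in> verts G. adjacent G u v}"
    have "card (verts G) > 0" using u fin by (auto simp: card_gt_0_iff)
    have "{v \<in> verts ?J. adjacent ?J (Inl (Inl u)) v} =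
        (\<lambda>u. Inl (Inl u)) ` (verts G - insert u ?A) \<union> (\<lambda>e. Inl (Inr e)) ` {e \<in> edges G. u \<in> e} \<union> Inr ` verts H"
      using u by (auto simp: verts_join adjacent_join adjacent_central_graph)
    then have "vdegree ?J (Inl (Inl u)) =
        card (verts G - insert u ?A) + card {e \<in> edges G. u \<in> e} + card (verts H)"
      using fin by (simp add: vdegree_def card_join_Un)
    also have "card {e \<in> edges G. u \<in> e} = card ?A"
      using card_edges_at[OF G] by (simp add: vdegree_def)
    also have "card (verts G - insert u ?A) + card ?A = card (verts G) - 1"
    proof -
      have "card (insert u ?A) = card ?A + 1" "card (insert u ?A) \<le> card (verts G)"
        using fin u not_adjacent_self[OF G, of u] by (simp, intro card_mono) auto
      then show ?thesis using fin u by (subst card_Diff_subset) auto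
    qed
    finally show ?thesis using \<open>card (verts G) > 0\<close> by simp
  qed
  show "vdegree ?J (Inl (Inr e)) = 2" if e: "e \<in> edges G"
  proof -
    \<comment> \<open>The empty images bring the set into the shape that \<open>card_join_Un\<close>
      expects.\<close>
    have "{v \<in> verts ?J. adjacent ?J (Inl (Inr e)) v} =
        (\<lambda>u. Inl (Inl u)) ` e \<union> (\<lambda>e. Inl (Inr e)) ` {} \<union> Inr ` {}"
      using e G by (auto simp: verts_join adjacent_join adjacent_central_graph simple_graph_def)
    moreover have "finite e" "card e = 2" using e G fin by (auto simp: simple_graph_def intro: finite_subset)
    ultimately show ?thesis unfolding vdegree_def by (simp only: card_join_Un finite.emptyI) simp
  qed
  show "vdegree ?J (Inr w) = vdegree H w + card (verts G)" if w: "w \<in> verts H"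
  proof -
    have "{v \<in> verts ?J. adjacent ?J (Inr w) v} =
        (\<lambda>u. Inl (Inl u)) ` verts G \<union> (\<lambda>e. Inl (Inr e)) ` {} \<union> Inr ` {v \<in> verts H. adjacent H w v}"
      using w by (auto simp: verts_join adjacent_join)
    moreover have "finite {v \<in> verts H. adjacent H w v}" using fin by simp
    ultimately show ?thesis unfolding vdegree_def using fin(1) by (simp only: card_join_Un finite.emptyI) simp
  qed
qed

text \<open>Square roots of degrees disappear from the result because the entries carrying them,
  \<open>k\<close> and \<open>d\<close> below, survive only as squares.\<close>

lemma rf_const_inverse_sqrt_square:
  "a \<ge> 0 \<Longrightarrow> rf_const (1 / sqrt a) * rf_const (1 / sqrt a) = 1 / rf_const a"
  by (simp flip: rf_const_hom(4) rf_const_divide add: rf_const_hom(2)[symmetric] del: rf_const_divide rf_const_hom)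

text \<open>\<open>D\<close> and \<open>q\<close> are the degrees that vertices of \<open>G\<close>
  and of \<open>H\<close> have in the join, and \<open>N\<close> is \<open>D\<close> as a field
  element.\<close>

locale regular_join =
  fixes G :: "'a sgraph" and H :: "'b sgraph" and n1 n2 m r1 r2 D q :: nat
    and us :: "'a list" and ws :: "'b list" and es :: "'a set list"
    and J x y N
  assumes G: "simple_graph G" "regular_graph G r1" and H: "simple_graph H" "regular_graph H r2"
    and us: "distinct us" "set us = verts G" "length us = n1"
    and ws: "distinct ws" "set ws = verts H" "length ws = n2"
    and es: "distinct es" "set es = edges G" "length es = m"
    and pos: "n1 \<ge> 1" "n2 \<ge> 1"
  defines "J \<equiv> central_vertex_join G H" and "x \<equiv> rf_X" and "y \<equiv> x - 1"
    and "D \<equiv> n1 + n2 - 1" and "N \<equiv> of_nat D :: real poly fract" and "q \<equiv> r2 + n1"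
begin

abbreviation "V1 u \<equiv> Inl (Inl u) :: ('a + 'a set) + 'b"
abbreviation "E e \<equiv> Inl (Inr e) :: ('a + 'a set) + 'b"
abbreviation "V2 w \<equiv> Inr w :: ('a + 'a set) + 'b"

lemma nonzero: "N \<noteq> 0" "of_nat q \<noteq> (0 :: real poly fract)" "y \<noteq> 0"
proof -
  show "N \<noteq> 0" using pos unfolding N_def D_def of_nat_eq_0_iff by simp
  show "of_nat q \<noteq> (0 :: real poly fract)" using pos unfolding q_def of_nat_eq_0_iff by simp
  show "y \<noteq> 0" unfolding y_def x_def by (rule rf_linear_nonzero')
qed

lemma vdegree_J:
  "u \<in> verts G \<Longrightarrow> vdegree J (V1 u) = D"
  "e \<in> edges G \<Longrightarrow> vdegree J (E e) = 2"
  "w \<in> verts H \<Longrightarrow> vdegree J (V2 w) = q"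
  using vdegree_join[OF G(1) H(1)] us ws H(2) distinct_card[of us] distinct_card[of ws]
  by (auto simp: J_def q_def D_def regular_graph_def)

text \<open>The entries of \<open>x I - L\<close> between a vertex of \<open>G\<close> and an
  incident edge vertex (\<open>k\<close>), and between vertices of \<open>G\<close> and
  \<open>H\<close> (\<open>d\<close>). The minus sign of the Laplacian cancels.\<close>

definition "k = rf_const (1 / sqrt (real D * 2))"
definition "d = rf_const (1 / sqrt (real D * real q))"

lemma k_square: "k * k = 1 / (2 * N)"
  unfolding k_def N_def by (subst rf_const_inverse_sqrt_square) (simp_all add: mult.commute)

lemma d_square: "d\<^sup>2 = 1 / (N * of_nat q)"
  unfolding d_def N_def power2_eq_square by (subst rf_const_inverse_sqrt_square) simp_all

lemma char_entry_J:
  "u \<in> verts G \<Longrightarrow> v \<in> verts G \<Longrightarrow>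
    char_entry J (V1 u) (V1 v) = (if u = v then y else if adjacent G u v then 0 else 1 / N)"
  "u \<in> verts G \<Longrightarrow> e \<in> edges G \<Longrightarrow> char_entry J (V1 u) (E e) = (if u \<in> e then k else 0)"
  "u \<in> verts G \<Longrightarrow> e \<in> edges G \<Longrightarrow> char_entry J (E e) (V1 u) = (if u \<in> e then k else 0)"
  "u \<in> verts G \<Longrightarrow> w \<in> verts H \<Longrightarrow> char_entry J (V1 u) (V2 w) = d"
  "u \<in> verts G \<Longrightarrow> w \<in> verts H \<Longrightarrow> char_entry J (V2 w) (V1 u) = d"
  "e \<in> edges G \<Longrightarrow> e' \<in> edges G \<Longrightarrow> char_entry J (E e) (E e') = (if e = e' then y else 0)"
  "e \<in> edges G \<Longrightarrow> w \<in> verts H \<Longrightarrow> char_entry J (E e) (V2 w) = 0"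
  "e \<in> edges G \<Longrightarrow> w \<in> verts H \<Longrightarrow> char_entry J (V2 w) (E e) = 0"
  "w \<in> verts H \<Longrightarrow> w' \<in> verts H \<Longrightarrow>
    char_entry J (V2 w) (V2 w') = (if w = w' then y else if adjacent H w w' then 1 / of_nat q else 0)"
  using nonzero not_adjacent_self[OF G(1)] not_adjacent_self[OF H(1)]
  unfolding char_entry_def nl_entry_def x_def[symmetric] y_def k_def d_def
  by (simp_all add: vdegree_J N_def, simp_all add: J_def adjacent_join adjacent_central_graph mult.commute)

text \<open>After the edge vertices are eliminated, the block of \<open>G\<close> is \<open>\<alpha> I + \<beta> L\<close> plus \<open>1 / N\<close>
  in every entry, where \<open>L\<close> is the normalized Laplacian of \<open>G\<close>.
  The block of \<open>H\<close> is \<open>t I - (r2 / q) L\<close>.\<close>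

definition "\<alpha> = (y\<^sup>2 - of_nat r1 / N - (1 + of_nat r1) * y / N) / y"
definition "\<beta> = of_nat r1 * (1 / N + 1 / (2 * N * y))"
definition "t = x - of_nat n1 / of_nat q"

text \<open>With \<open>A\<close> the adjacency matrix of \<open>G\<close> and \<open>1\<close> the
  all-ones matrix, the complement is \<open>y I + (1 - I - A) / N - (A + r1 I) / (2 N y)\<close>.
  Substituting \<open>A = r1 (I - L)\<close> and collecting terms gives \<open>\<alpha>\<close> and
  \<open>\<beta>\<close>.\<close>

lemma Schur_entry_G:
  assumes u: "u \<in> verts G" and v: "v \<in> verts G"
  shows "char_entry J (V1 u) (V1 v) - (\<Sum>e\<in>edges G. char_entry J (V1 u) (E e) * (char_entry J (E e) (V1 v) / y)) =
    ((if u = v then \<alpha> else 0) + \<beta> * rf_const (nl_entry G u v)) + 1 / N"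
proof -
  have "(\<Sum>e\<in>edges G. char_entry J (V1 u) (E e) * (char_entry J (E e) (V1 v) / y)) =
      (\<Sum>e\<in>edges G. if u \<in> e \<and> v \<in> e then k * k / y else 0)"
    using u v by (intro sum.cong) (auto simp: char_entry_J)
  also have "\<dots> = (if u = v then of_nat r1 else of_bool (adjacent G u v)) * (1 / (2 * N * y))"
    using G u v unfolding sum_incidence[OF G(1)] k_square by (auto simp: regular_graph_def)
  finally have 1: "(\<Sum>e\<in>edges G. char_entry J (V1 u) (E e) * (char_entry J (E e) (V1 v) / y)) =
      (if u = v then of_nat r1 else of_bool (adjacent G u v)) * (1 / (2 * N * y))" .
  have "rf_const (real r1 * nl_entry G u v) = (if u = v then of_nat r1 else 0) - of_bool (adjacent G u v)"
    unfolding nl_entry_regular'[OF G u v] by simp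
  then have 2: "\<beta> * rf_const (nl_entry G u v) =
      ((if u = v then of_nat r1 else 0) - of_bool (adjacent G u v)) * (1 / N + 1 / (2 * N * y))"
    by (simp add: \<beta>_def mult_ac)
  show ?thesis
    unfolding 1 2 char_entry_J(1)[OF u v] \<alpha>_def
    using nonzero not_adjacent_self[OF G(1), of v] by (auto simp: field_simps power2_eq_square)
qed

text \<open>The block is \<open>y I + A / q\<close> with \<open>A = r2 (I - L)\<close>, and
  \<open>y + r2 / q = t\<close> because \<open>q = r2 + n1\<close>.\<close>

lemma char_entry_H:
  assumes u: "u \<in> verts H" and v: "v \<in> verts H"
  shows "char_entry J (V2 u) (V2 v) = (if u = v then t else 0) + (- (of_nat r2 / of_nat q)) * rf_const (nl_entry H u v)"
proof -
  have "rf_const (real r2 * nl_entry H u v) = (if u = v then of_nat r2 else 0) - of_bool (adjacent H u v)"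
    unfolding nl_entry_regular'[OF H u v] by simp
  moreover have "(- (of_nat r2 / of_nat q)) * rf_const (nl_entry H u v) = - rf_const (real r2 * nl_entry H u v) / of_nat q"
    by simp
  ultimately have 1: "(- (of_nat r2 / of_nat q)) * rf_const (nl_entry H u v) =
      - ((if u = v then of_nat r2 else 0) - of_bool (adjacent H u v)) / of_nat q"
    by (simp only:)
  have "of_nat n1 / of_nat q + of_nat r2 / of_nat q = (1 :: real poly fract)"
    using nonzero(2) by (simp add: q_def add.commute flip: add_divide_distrib)
  then have "t = y + of_nat r2 / of_nat q" by (simp add: t_def y_def algebra_simps)
  then show ?thesis
    unfolding 1 char_entry_J(9)[OF u v] using not_adjacent_self[OF H(1), of v] by auto
qed

text \<open>The edge block is \<open>y I\<close>, so the witness for the Schur complement is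
  division by \<open>y\<close>. Edge vertices are not adjacent to \<open>H\<close>, so only the
  block of \<open>G\<close> changes.\<close>

lemma det_char_entry_J:
  assumes vs: "distinct vs" "set vs = verts J"
  shows "det (list_mat (char_entry J) vs vs) = y ^ m *
    det (four_block_mat
      (list_mat (\<lambda>u v. ((if u = v then \<alpha> else 0) + \<beta> * rf_const (nl_entry G u v)) + 1 / N) us us)
      (list_mat (\<lambda>_ _. d) us ws) (list_mat (\<lambda>_ _. d) ws us)
      (list_mat (\<lambda>u v. (if u = v then t else 0) + (- (of_nat r2 / of_nat q)) * rf_const (nl_entry H u v)) ws ws))"
    (is "_ = _ * det ?S")
proof -
  let ?E = "map E es" and ?V = "map V1 us @ map V2 ws"
  let ?K = "char_entry J"
  have "mset vs = mset (?E @ ?V)"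
    using vs us es ws
    by (intro set_eq_iff_mset_eq_distinct[THEN iffD1]) (auto simp: distinct_map inj_on_def J_def verts_join)
  then have "det (list_mat ?K vs vs) = det (list_mat ?K (?E @ ?V) (?E @ ?V))"
    by (rule det_list_mat_perm)
  also have "\<dots> = det (list_mat ?K ?E ?E) *
      det (list_mat ?K ?V ?V - list_mat ?K ?V ?E * list_mat (\<lambda>e v. ?K e v / y) ?E ?V)"
    unfolding list_mat_append[of _ ?E]
  proof (rule det_four_block_schur_left[of _ "length ?E" _ "length ?V"])
    have "(\<Sum>e'\<in>edges G. ?K (E e) (E e') * (?K (E e') v / y)) = ?K (E e) v" if "e \<in> edges G" for e v
    proof -
      have "(\<Sum>e'\<in>edges G. ?K (E e) (E e') * (?K (E e') v / y)) =
          (\<Sum>e'\<in>edges G. if e = e' then ?K (E e) v else 0)"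
        using that nonzero by (intro sum.cong) (auto simp: char_entry_J)
      then show ?thesis using that finite_edges[OF G(1)] by simp
    qed
    then show "list_mat ?K ?E ?E * list_mat (\<lambda>e v. ?K e v / y) ?E ?V = list_mat ?K ?E ?V"
      using es by (subst list_mat_mult) (auto simp: distinct_map inj_on_def sum.reindex intro!: list_mat_cong)
  qed (auto intro!: carrier_matI)
  also have "list_mat ?K ?E ?E = list_mat (\<lambda>e e'. if e = e' then y else 0) es es"
    unfolding list_mat_map using es by (intro list_mat_cong) (simp add: char_entry_J)
  also have "det \<dots> = y ^ m" using det_list_mat_diag[OF es(1), of y] es(3) by simp
  also have "list_mat ?K ?V ?V - list_mat ?K ?V ?E * list_mat (\<lambda>e v. ?K e v / y) ?E ?V =
      list_mat (\<lambda>u v. ?K u v - (\<Sum>e\<in>edges G. ?K u (E e) * (?K (E e) v / y))) ?V ?V"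
    using es by (subst list_mat_mult) (auto simp: distinct_map inj_on_def sum.reindex list_mat_minus)
  also have "\<dots> = ?S"
    unfolding list_mat_append list_mat_map
    by (intro cong_four_block_mat list_mat_cong; simp only: us(2) ws(2) Schur_entry_G)
      (simp_all add: char_entry_H char_entry_J(4,5,7,8))
  finally show ?thesis .
qed

text \<open>These are the row sums that \<open>det_join\<close> needs to be nonzero. Multiplied by
  \<open>y\<close>, the first two become monic quadratics in \<open>y\<close>; adding
  \<open>n1 / N\<close> only alters the linear coefficient.\<close>

lemma \<alpha>_nonzero: "\<alpha> \<noteq> 0"
  and S_nonzero: "\<alpha> + 1 / N * of_nat n1 \<noteq> 0"
  and t_nonzero: "t \<noteq> 0"
proof -
  define NN where "NN = real D"
  have N: "N = rf_const NN" by (simp only: N_def NN_def rf_const_of_nat)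
  have "y\<^sup>2 - rf_const (r1 / NN) - rf_const ((1 + real r1) / NN) * y \<noteq> 0"
    unfolding y_def x_def by (rule rf_quadratic_nonzero)
  moreover have "\<alpha> * y = y\<^sup>2 - rf_const (r1 / NN) - rf_const ((1 + real r1) / NN) * y"
    using nonzero by (simp add: \<alpha>_def N)
  ultimately show "\<alpha> \<noteq> 0" by auto
  have "y\<^sup>2 - rf_const (r1 / NN) - rf_const ((1 + real r1 - real n1) / NN) * y \<noteq> 0"
    unfolding y_def x_def by (rule rf_quadratic_nonzero)
  moreover have "(\<alpha> + 1 / N * of_nat n1) * y = y\<^sup>2 - rf_const (r1 / NN) - rf_const ((1 + real r1 - real n1) / NN) * y"
    using nonzero by (simp add: \<alpha>_def N field_simps)
  ultimately show "\<alpha> + 1 / N * of_nat n1 \<noteq> 0" by auto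
  have "x - rf_const (real n1 / real q) \<noteq> 0"
    unfolding x_def by (rule rf_linear_nonzero)
  then show "t \<noteq> 0" by (simp add: t_def)
qed

lemma det_char_entry_J_spectrum:
  assumes vs: "distinct vs" "set vs = verts J"
    and \<mu>: "char_poly (normalized_laplacian G us) = (\<Prod>a\<leftarrow>0 # \<mu>s. [:- a, 1:])"
    and \<nu>: "char_poly (normalized_laplacian H ws) = (\<Prod>a\<leftarrow>0 # \<nu>s. [:- a, 1:])"
  shows "det (list_mat (char_entry J) vs vs) = y ^ m *
    ((\<Prod>a\<leftarrow>\<mu>s. \<alpha> + \<beta> * rf_const a) * (\<Prod>a\<leftarrow>\<nu>s. t + (- (of_nat r2 / of_nat q)) * rf_const a) *
     ((\<alpha> + 1 / N * of_nat n1) * t - d\<^sup>2 * of_nat n1 * of_nat n2))"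
proof -
  let ?f = "\<lambda>u v. (if u = v then \<alpha> else 0) + \<beta> * rf_const (nl_entry G u v)"
  let ?g = "\<lambda>u v. (if u = v then t else 0) + (- (of_nat r2 / of_nat q)) * rf_const (nl_entry H u v)"
  let ?M = "four_block_mat (list_mat (\<lambda>u v. ?f u v + 1 / N) us us)
      (list_mat (\<lambda>_ _. d) us ws) (list_mat (\<lambda>_ _. d) ws us) (list_mat ?g ws ws)"
  \<comment> \<open>Rows of the Laplacian sum to zero, so only the multiple of the identity
    remains.\<close>
  have row: "(\<Sum>v\<in>verts K. (if u = v then a else 0) + b * rf_const (nl_entry K u v)) = a"
    if "simple_graph K" "regular_graph K r" "u \<in> verts K" for K :: "'c sgraph" and r u a b
    using that nl_entry_row_sums(1)[OF that]
    by (simp add: sum.distrib sum_distrib_left[symmetric] rf_const_sum[symmetric] simple_graph_def)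
  have "det ?M * (\<alpha> * t) = det (list_mat ?f us us) * det (list_mat ?g ws ws) *
      ((\<alpha> + 1 / N * of_nat (length us)) * t - d\<^sup>2 * of_nat (length us) * of_nat (length ws))"
  proof (rule det_join)
    show "(\<Sum>v\<in>set us. ?f u v) = \<alpha>" if "u \<in> set us" for u
      using that row[OF G, of u \<alpha> \<beta>] unfolding us(2) by blast
    show "(\<Sum>v\<in>set ws. ?g u v) = t" if "u \<in> set ws" for u
      using that row[OF H, of u t "- (of_nat r2 / of_nat q)"] unfolding ws(2) by blast
  qed (use us ws \<alpha>_nonzero t_nonzero S_nonzero in simp_all)
  \<comment> \<open>The eigenvalue \<open>0\<close> contributes the factor \<open>\<alpha>\<close>,
    and likewise \<open>t\<close> for \<open>H\<close>; both cancel against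
    \<open>\<alpha> * t\<close>.\<close>
  also have "det (list_mat ?f us us) = \<alpha> * (\<Prod>a\<leftarrow>\<mu>s. \<alpha> + \<beta> * rf_const a)"
    unfolding det_nl_entry_affine[OF us(1) \<mu>] by simp
  also have "det (list_mat ?g ws ws) = t * (\<Prod>a\<leftarrow>\<nu>s. t + (- (of_nat r2 / of_nat q)) * rf_const a)"
    unfolding det_nl_entry_affine[OF ws(1) \<nu>] by simp
  finally have "det ?M = (\<Prod>a\<leftarrow>\<mu>s. \<alpha> + \<beta> * rf_const a) * (\<Prod>a\<leftarrow>\<nu>s. t + (- (of_nat r2 / of_nat q)) * rf_const a) *
      ((\<alpha> + 1 / N * of_nat n1) * t - d\<^sup>2 * of_nat n1 * of_nat n2)"
    using \<alpha>_nonzero t_nonzero unfolding us ws by (simp add: mult_ac)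
  then show ?thesis using det_char_entry_J[OF vs] by simp
qed

lemma main_factor:
  "y * ((\<alpha> + 1 / N * of_nat n1) * t - d\<^sup>2 * of_nat n1 * of_nat n2) =
   (x - of_nat n1 / (of_nat r2 + of_nat n1)) * (y\<^sup>2 - of_nat r1 / N - (1 + of_nat r1) * y / N)
     - (of_nat n1 * of_nat n2 * y - of_nat n1 * y * (x * of_nat n1 + x * of_nat r2 - of_nat n1))
       / (N * (of_nat n1 + of_nat r2))"
proof -
  define p where "p = y\<^sup>2 - of_nat r1 / N - (1 + of_nat r1) * y / N"
  have q: "of_nat q = of_nat n1 + (of_nat r2 :: real poly fract)" by (simp add: q_def)
  have nz: "of_nat n1 + (of_nat r2 :: real poly fract) \<noteq> 0" using nonzero q by simp
  have "y * \<alpha> = p" using nonzero by (simp add: \<alpha>_def p_def)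
  then have "y * ((\<alpha> + 1 / N * of_nat n1) * t - d\<^sup>2 * of_nat n1 * of_nat n2) =
      (p + y / N * of_nat n1) * t - y * d\<^sup>2 * of_nat n1 * of_nat n2"
    by (simp add: algebra_simps)
  also have "\<dots> = (x - of_nat n1 / (of_nat r2 + of_nat n1)) * p
     - (of_nat n1 * of_nat n2 * y - of_nat n1 * y * (x * of_nat n1 + x * of_nat r2 - of_nat n1))
       / (N * (of_nat n1 + of_nat r2))"
    unfolding d_square t_def q add.commute[of "of_nat r2" "of_nat n1"]
    using nonzero(1) nz by (simp add: divide_simps) (simp add: algebra_simps)
  finally show ?thesis unfolding p_def .
qed

text \<open>One power of \<open>y\<close> per remaining eigenvalue of \<open>G\<close> clears the
  denominators of \<open>\<alpha>\<close> and \<open>\<beta>\<close>.\<close>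

lemma \<mu>_factor:
  "y * (\<alpha> + \<beta> * c) = y\<^sup>2 - of_nat r1 / N - (1 + of_nat r1) * y / N
      + of_nat r1 * c / (2 * N) + of_nat r1 * y * c / N"
  using nonzero unfolding \<alpha>_def \<beta>_def by (simp add: field_simps power2_eq_square)

end

section \<open>Assembly of the closed formula\<close>

lemma prod_list_nth_shift:
  assumes "\<And>i. i < length as \<Longrightarrow> e (i + 2) = as ! i"
  shows "(\<Prod>a\<leftarrow>as. f a) = (\<Prod>i = 2..Suc (length as). f (e i))"
proof -
  have "(\<Prod>i = 2..Suc (length as). f (e i)) = (\<Prod>i<length as. f (e (i + 2)))"
    by (rule prod.reindex_bij_witness[of _ "\<lambda>i. i + 2" "\<lambda>i. i - 2"]) (auto simp del: add_2_eq_Suc')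
  also have "\<dots> = (\<Prod>a\<leftarrow>as. f a)"
    using assms by (simp add: prod.list_conv_set_nth atLeast0LessThan)
  finally show ?thesis ..
qed

theorem theorem4p1:
  fixes G1 :: "'a sgraph" and G2 :: "'b sgraph"
    and n1 n2 m1 m2 r1 r2 :: nat
    and vs1 :: "'a list" and vs2 :: "'b list" and vs :: "(('a + 'a set) + 'b) list"
    and x N :: "real poly fract"
    and \<mu>1 \<mu>2 :: "nat \<Rightarrow> real poly fract"
  assumes "simple_graph G1" and "simple_graph G2"
    and "n1 = card (verts G1)" and "n2 = card (verts G2)"
    and "m1 = card (edges G1)" and "m2 = card (edges G2)"
    and "n1 \<ge> 1" and "n2 \<ge> 1"
    and "regular_graph G1 r1" and "regular_graph G2 r2"
    and "vertex_enum G1 vs1" and "vertex_enum G2 vs2"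
    and "vertex_enum (central_vertex_join G1 G2) vs"
    and "x = rf_X"
    and "N = of_nat n1 + of_nat n2 - 1"
    and "\<mu>1 = (\<lambda>i. rf_const (nl_eigenvalue G1 vs1 i))"
    and "\<mu>2 = (\<lambda>i. rf_const (nl_eigenvalue G2 vs2 i))"
  shows "to_fract (char_poly (normalized_laplacian (central_vertex_join G1 G2) vs)) =
    (x - 1) powi (int m1 - int n1)
    * (\<Prod>i = 2..n2. x - of_nat n1 / (of_nat r2 + of_nat n1)
                      - of_nat r2 / (of_nat r2 + of_nat n1) * \<mu>2 i)
    * ((x - of_nat n1 / (of_nat r2 + of_nat n1))
         * ((x - 1)\<^sup>2 - of_nat r1 / N - (1 + of_nat r1) * (x - 1) / N)
       - (of_nat n1 * of_nat n2 * (x - 1)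
          - of_nat n1 * (x - 1) * (x * of_nat n1 + x * of_nat r2 - of_nat n1))
         / (N * (of_nat n1 + of_nat r2)))
    * (\<Prod>i = 2..n1. (x - 1)\<^sup>2 - of_nat r1 / N - (1 + of_nat r1) * (x - 1) / N
                      + of_nat r1 * \<mu>1 i / (2 * N)
                      + of_nat r1 * (x - 1) * \<mu>1 i / N)"
proof -
  have fin: "finite (verts G1)" "finite (verts G2)" using assms(1,2) by (simp_all add: simple_graph_def)
  obtain es where es: "set es = edges G1" "distinct es"
    using finite_distinct_list[OF finite_edges[OF assms(1)]] by blast
  have us: "distinct vs1" "set vs1 = verts G1" "length vs1 = n1"
    and ws: "distinct vs2" "set vs2 = verts G2" "length vs2 = n2"
    using assms(3,4,11,12) distinct_card[of vs1] distinct_card[of vs2] by (auto simp: vertex_enum_def)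
  interpret regular_join G1 G2 n1 n2 m1 r1 r2 "n1 + n2 - 1" "r2 + n1" vs1 vs2 es
      "central_vertex_join G1 G2" rf_X "rf_X - 1" "of_nat (n1 + n2 - 1)"
    using assms(1,2,5,7,8,9,10) us ws es distinct_card[of es] by unfold_locales auto
  have ne: "verts G1 \<noteq> {}" "verts G2 \<noteq> {}" using assms(3,4,7,8) by auto
  obtain \<mu>s where \<mu>s: "char_poly (normalized_laplacian G1 vs1) = (\<Prod>a\<leftarrow>0 # \<mu>s. [:- a, 1:])"
      "n1 = Suc (length \<mu>s)" "\<And>i. i < length \<mu>s \<Longrightarrow> nl_eigenvalue G1 vs1 (i + 2) = \<mu>s ! i"
    using regular_nl_spectrum[OF assms(1,9,11) ne(1)] us(3) by metis
  obtain \<nu>s where \<nu>s: "char_poly (normalized_laplacian G2 vs2) = (\<Prod>a\<leftarrow>0 # \<nu>s. [:- a, 1:])"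
      "n2 = Suc (length \<nu>s)" "\<And>i. i < length \<nu>s \<Longrightarrow> nl_eigenvalue G2 vs2 (i + 2) = \<nu>s ! i"
    using regular_nl_spectrum[OF assms(2,10,12) ne(2)] ws(3) by metis
  let ?y = "x - 1"
  \<comment> \<open>The truncated subtraction is exact since \<open>n1 \<ge> 1\<close>.\<close>
  have N: "of_nat (n1 + n2 - 1) = N"
    using assms(7,15) by (simp add: of_nat_diff)
  have nz: "?y \<noteq> 0" using nonzero(3) assms(14) by simp
  have vs: "distinct vs" "set vs = verts (central_vertex_join G1 G2)"
    using assms(13) by (auto simp: vertex_enum_def)
  let ?P = "\<lambda>c. ?y\<^sup>2 - of_nat r1 / N - (1 + of_nat r1) * ?y / N + of_nat r1 * c / (2 * N) + of_nat r1 * ?y * c / N"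
  let ?B = "(\<alpha> + 1 / N * of_nat n1) * t - d\<^sup>2 * of_nat n1 * of_nat n2"
  have P1: "?y ^ length \<mu>s * (\<Prod>a\<leftarrow>\<mu>s. \<alpha> + \<beta> * rf_const a) = (\<Prod>i = 2..n1. ?P (\<mu>1 i))"
  proof -
    have "?y ^ length as * (\<Prod>a\<leftarrow>as. \<alpha> + \<beta> * rf_const a) = (\<Prod>a\<leftarrow>as. ?y * (\<alpha> + \<beta> * rf_const a))" for as
      by (induction as) (simp_all add: mult_ac)
    also have "(\<Prod>a\<leftarrow>\<mu>s. ?y * (\<alpha> + \<beta> * rf_const a)) = (\<Prod>a\<leftarrow>\<mu>s. ?P (rf_const a))"
      using \<mu>_factor[unfolded N] assms(14) by simp
    also have "\<dots> = (\<Prod>i = 2..n1. ?P (\<mu>1 i))"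
      unfolding assms(16) \<mu>s(2) by (rule prod_list_nth_shift) (rule \<mu>s(3))
    finally show ?thesis .
  qed
  have P2: "(\<Prod>a\<leftarrow>\<nu>s. t + (- (of_nat r2 / of_nat (r2 + n1))) * rf_const a) =
      (\<Prod>i = 2..n2. x - of_nat n1 / (of_nat r2 + of_nat n1) - of_nat r2 / (of_nat r2 + of_nat n1) * \<mu>2 i)"
    unfolding assms(17) \<nu>s(2) t_def
    by (subst prod_list_nth_shift[OF \<nu>s(3)]) (simp_all add: assms(14))
  have "to_fract (char_poly (normalized_laplacian (central_vertex_join G1 G2) vs)) =
      ?y ^ m1 * ((\<Prod>a\<leftarrow>\<mu>s. \<alpha> + \<beta> * rf_const a) *
        (\<Prod>a\<leftarrow>\<nu>s. t + (- (of_nat r2 / of_nat (r2 + n1))) * rf_const a) * ?B)"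
    unfolding to_fract_char_poly_normalized_laplacian[OF vs(1)]
      det_char_entry_J_spectrum[OF vs \<mu>s(1) \<nu>s(1)] N assms(14) by (rule refl)
  \<comment> \<open>Of the \<open>m1\<close> powers of \<open>y\<close>, \<open>n1 - 1\<close> go to
    the product over the eigenvalues of \<open>G1\<close> and one to the middle factor. The exponent
    \<open>m1 - n1\<close> left over may be negative, hence \<open>powi\<close>.\<close>
  also have "?y ^ m1 = ?y powi (int m1 - int n1) * (?y ^ length \<mu>s * ?y)"
  proof -
    have "?y powi (int m1 - int n1 + int n1) = ?y powi (int m1 - int n1) * ?y powi (int n1)"
      using nz by (intro power_int_add) simp
    also have "?y powi (int n1) = ?y ^ length \<mu>s * ?y"
      unfolding power_int_of_nat \<mu>s(2) by (simp add: mult.commute)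
    finally show ?thesis by simp
  qed
  finally have "to_fract (char_poly (normalized_laplacian (central_vertex_join G1 G2) vs)) =
      ?y powi (int m1 - int n1) * (\<Prod>a\<leftarrow>\<nu>s. t + (- (of_nat r2 / of_nat (r2 + n1))) * rf_const a) *
      (?y * ?B) * (?y ^ length \<mu>s * (\<Prod>a\<leftarrow>\<mu>s. \<alpha> + \<beta> * rf_const a))"
    by (simp only: mult_ac)
  then show ?thesis
    unfolding P1 P2 using main_factor[unfolded N] assms(14) by simp
qed

end
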